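(* Let $h:\mathbb{R}^n\to\mathbb{R}$ and suppose $\overline{x}=0\in\operatorname{argmin}_{\mathbb{R}^n}h$. If $h$ is positively homogeneous of degree $p>0$, then $h$ is star quasiconvex with respect to $\overline{x}=0$.
   Context: $h$ is positively homogeneous of degree $p$ if $h(\lambda x)=\lambda^p h(x)$ for all $x\in\mathbb{R}^n$ and $\lambda>0$. For $\overline{x}\in\operatorname{argmin}_{\mathbb{R}^n}h$ (set of global minimizers), $h$ is star quasiconvex with respect to $\overline{x}$ if $h(\lambda\overline{x}+(1-\lambda)y)\le h(y)$ for every $y\in\mathbb{R}^n$ and $\lambda\in[0,1]$. *)

theory Defs
  imports "HOL-Analysis.Analysis"
begin

definition argmin :: "('a \<Rightarrow> real) \<Rightarrow> 'a set" where
  "argmin h = {x. is_arg_min h (\<lambda>_. True) x}"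

definition positively_homogeneous :: "real \<Rightarrow> ('a::real_vector \<Rightarrow> real) \<Rightarrow> bool" where
  "positively_homogeneous p h \<longleftrightarrow> (\<forall>x. \<forall>c>0. h (c *\<^sub>R x) = c powr p * h x)"

text \<open>Star quasiconvexity is only considered at global minimizers. The definition need not
  demand this: taking \<open>c = 1\<close> gives \<open>h xbar \<le> h y\<close> for every \<open>y\<close>.\<close>

definition star_quasiconvex :: "('a::real_vector \<Rightarrow> real) \<Rightarrow> 'a \<Rightarrow> bool" where
  "star_quasiconvex h xbar \<longleftrightarrow>
     (\<forall>y. \<forall>c\<in>{0..1}. h (c *\<^sub>R xbar + (1 - c) *\<^sub>R y) \<le> h y)"

end

theory Submission
  imports Defs
begin

text \<open>Homogeneity forces \<open>h 0 = 0\<close> (\<open>positively_homogeneous_zero\<close>),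
  so minimality at 0 makes \<open>h\<close> nonnegative. Moving from \<open>y\<close> towards 0
  scales \<open>y\<close> by some t in [0,1]; for t > 0 this multiplies \<open>h y >= 0\<close> by
  t^p <= 1, so the value cannot increase.\<close>

lemma argmin_le:
  assumes "x \<in> argmin h"
  shows "h x \<le> h y"
  using assms by (simp add: argmin_def is_arg_min_def not_less)

text \<open>Scaling by 2 fixes the origin, while 2^p differs from 1.\<close>

lemma positively_homogeneous_zero:
  assumes "positively_homogeneous p h" and "p > 0"
  shows "h 0 = 0"
proof -
  have "h (2 *\<^sub>R 0) = 2 powr p * h 0"
    using assms(1) unfolding positively_homogeneous_def by (metis zero_less_numeral)
  then show ?thesis
    using assms(2) by simp
qed

theorem proposition23:
  fixes h :: "real ^ 'n \<Rightarrow> real" and p :: real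
  assumes "0 \<in> argmin h"
    and "p > 0"
    and "positively_homogeneous p h"
  shows "star_quasiconvex h 0"
  unfolding star_quasiconvex_def
proof (intro allI ballI)
  fix y :: "real ^ 'n" and c :: real
  assume c: "c \<in> {0..1}"
  show "h (c *\<^sub>R 0 + (1 - c) *\<^sub>R y) \<le> h y"
  \<comment> \<open>At \<open>c = 1\<close> the scaling factor \<open>1 - c\<close> is 0, which
    homogeneity does not cover; minimality of 0 settles this case directly.\<close>
  proof (cases "c = 1")
    case True
    then show ?thesis
      using argmin_le[OF assms(1)] by simp
  next
    case False
    with c have "0 < 1 - c" and "1 - c \<le> 1"
      by auto
    then have "h ((1 - c) *\<^sub>R y) = (1 - c) powr p * h y" and "(1 - c) powr p \<le> 1"
      using assms(2,3) by (auto simp: positively_homogeneous_def powr_le1)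
    moreover have "0 \<le> h y"
      using argmin_le[OF assms(1), of y] positively_homogeneous_zero[OF assms(3,2)] by simp
    ultimately show ?thesis
      by (simp add: mult_left_le_one_le)
  qed
qed

end
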